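(* Let $(H,K)\in\mathbb{C}^{m\times m}\times\mathbb{C}^{m\times m}$ be a proper normal Hessenberg pencil with set of poles $\Xi$. Let $\tilde z\in\mathbb{C}$ be an eigenvalue of $(H,K)$ with $\tilde z\notin\Xi$. Let $\hat s\in\mathbb{C}^m$ be a right eigenvector and $\hat r\in\mathbb{C}^m$ a left eigenvector of $(H,K)$ corresponding to $\tilde z$, i.e. $H\hat s=\tilde z K\hat s$ and $\hat r^H H=\tilde z\,\hat r^H K$, with $\Vert\hat s\Vert_2=\Vert\hat r\Vert_2=1$. Let $\hat R,\hat S\in\mathbb{C}^{m\times m}$ be unitary matrices with $\hat R e_1=\hat r$ and $\hat S e_1=\hat s$. Then the equivalent pencil $\hat R^H(H,K)\hat S=(\hat R^H H\hat S,\hat R^H K\hat S)$ isolates the eigenvalue $\tilde z$ in the upper left corner, that is, $$\hat R^H H\hat S=\begin{bmatrix}\tilde h & \boldsymbol{0}\\ \boldsymbol{0} & \tilde H_{m-1}\end{bmatrix},\qquad \hat R^H K\hat S=\begin{bmatrix}\tilde k & \boldsymbol{0}\\ \boldsymbol{0} & \tilde K_{m-1}\end{bmatrix},$$ for some $\tilde h,\tilde k\in\mathbb{C}$ with $\tilde k\neq 0$ and $\tilde h/\tilde k=\tilde z$, and some $\tilde H_{m-1},\tilde K_{m-1}\in\mathbb{C}^{(m-1)\times(m-1)}$.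
   Context: Notation: $A^H$ is the conjugate transpose of $A$, $e_1$ is the first standard basis vector of $\mathbb{C}^m$, and $\overline{\mathbb{C}}=\mathbb{C}\cup\{\infty\}$. A Hessenberg pencil is a pair $(H,K)$ of $m\times m$ complex (upper) Hessenberg matrices, i.e. $h_{i,j}=k_{i,j}=0$ whenever $i>j+1$. A Hessenberg pencil $(H,K)$ is called proper if (i) $|h_{\ell+1,\ell}|+|k_{\ell+1,\ell}|\neq 0$ for $\ell=1,\dots,m-1$ (the subdiagonal elements are never simultaneously zero), (ii) the first columns of $H$ and $K$ are linearly independent, and (iii) the last rows of $H$ and $K$ are linearly independent. The poles of a proper Hessenberg pencil are the ratios $\xi_i=h_{i+1,i}/k_{i+1,i}\in\overline{\mathbb{C}}$, $i=1,\dots,m-1$ (with $\xi_i=\infty$ if $k_{i+1,i}=0$), and $\Xi=\{\xi_1,\dots,\xi_{m-1}\}$. A Hessenberg pencil $(H,K)$ is called normal if $H$ and $K$ are simultaneously unitarily diagonalizable in the sense of equivalence: there exist unitary matrices $R,S\in\mathbb{C}^{m\times m}$ such that $R^H H S$ and $R^H K S$ are both diagonal. A number $\tilde z\in\mathbb{C}$ is an eigenvalue of $(H,K)$ if $\det(H-\tilde z K)=0$; eigenvectors are nonzero vectors. *)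

theory Defs
  imports
    "Jordan_Normal_Form.Schur_Decomposition"
    "HOL-Analysis.L2_Norm"
begin

text \<open>Rows and columns of matrices are numbered from 0, so \<open>A $$ (i, j)\<close> is the entry
  $a_{i+1,j+1}$. The conjugate transpose is \<open>mat_adjoint\<close>.\<close>

definition vec_norm2 :: "complex vec \<Rightarrow> real" where
  "vec_norm2 v = L2_set (\<lambda>i. cmod (v $ i)) {0..<dim_vec v}"

definition unitary_mat :: "nat \<Rightarrow> complex mat \<Rightarrow> bool" where
  "unitary_mat m U \<longleftrightarrow>
     U \<in> carrier_mat m m \<and> mat_adjoint U * U = 1\<^sub>m m \<and> U * mat_adjoint U = 1\<^sub>m m"

text \<open>\<open>module.lin_dep\<close> is a predicate on sets; the condition \<open>v \<noteq> w\<close> makes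
  \<open>lin_indep_pair\<close> linear independence of the family $(v, w)$.\<close>

definition lin_indep_pair :: "nat \<Rightarrow> complex vec \<Rightarrow> complex vec \<Rightarrow> bool" where
  "lin_indep_pair m v w \<longleftrightarrow>
     v \<noteq> w \<and> \<not> module.lin_dep class_ring (module_vec TYPE(complex) m) {v, w}"

definition hessenberg_mat :: "nat \<Rightarrow> complex mat \<Rightarrow> bool" where
  "hessenberg_mat m A \<longleftrightarrow>
     A \<in> carrier_mat m m \<and> (\<forall>i<m. \<forall>j<m. i > j + 1 \<longrightarrow> A $$ (i, j) = 0)"

definition hessenberg_pencil :: "nat \<Rightarrow> complex mat \<Rightarrow> complex mat \<Rightarrow> bool" where
  "hessenberg_pencil m H K \<longleftrightarrow> hessenberg_mat m H \<and> hessenberg_mat m K"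

definition proper_pencil :: "nat \<Rightarrow> complex mat \<Rightarrow> complex mat \<Rightarrow> bool" where
  "proper_pencil m H K \<longleftrightarrow>
     (\<forall>l<m - 1. cmod (H $$ (l + 1, l)) + cmod (K $$ (l + 1, l)) \<noteq> 0) \<and>
     lin_indep_pair m (col H 0) (col K 0) \<and>
     lin_indep_pair m (row H (m - 1)) (row K (m - 1))"

datatype ext_complex = Finite complex | Infty

definition pole :: "complex mat \<Rightarrow> complex mat \<Rightarrow> nat \<Rightarrow> ext_complex" where
  "pole H K i =
     (if K $$ (i + 1, i) = 0 then Infty else Finite (H $$ (i + 1, i) / K $$ (i + 1, i)))"

definition poles :: "nat \<Rightarrow> complex mat \<Rightarrow> complex mat \<Rightarrow> ext_complex set" where
  "poles m H K = pole H K ` {0..<m - 1}"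

definition normal_pencil :: "nat \<Rightarrow> complex mat \<Rightarrow> complex mat \<Rightarrow> bool" where
  "normal_pencil m H K \<longleftrightarrow>
     (\<exists>R S. unitary_mat m R \<and> unitary_mat m S \<and>
        diagonal_mat (mat_adjoint R * H * S) \<and> diagonal_mat (mat_adjoint R * K * S))"

definition pencil_eigenvalue :: "complex mat \<Rightarrow> complex mat \<Rightarrow> complex \<Rightarrow> bool" where
  "pencil_eigenvalue H K z \<longleftrightarrow> det (H - z \<cdot>\<^sub>m K) = 0"

definition right_eigenvector ::
  "nat \<Rightarrow> complex mat \<Rightarrow> complex mat \<Rightarrow> complex \<Rightarrow> complex vec \<Rightarrow> bool" where
  "right_eigenvector m H K z s \<longleftrightarrow>
     s \<in> carrier_vec m \<and> s \<noteq> 0\<^sub>v m \<and> H *\<^sub>v s = z \<cdot>\<^sub>v (K *\<^sub>v s)"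

text \<open>\<open>mat_of_row (conjugate r)\<close> is the row vector $r^H$.\<close>

definition left_eigenvector ::
  "nat \<Rightarrow> complex mat \<Rightarrow> complex mat \<Rightarrow> complex \<Rightarrow> complex vec \<Rightarrow> bool" where
  "left_eigenvector m H K z r \<longleftrightarrow>
     r \<in> carrier_vec m \<and> r \<noteq> 0\<^sub>v m \<and>
     mat_of_row (conjugate r) * H = z \<cdot>\<^sub>m (mat_of_row (conjugate r) * K)"

end

theory Submission
  imports Defs
begin

text \<open>
  Put \<open>B = H - z K\<close>. The pencil has its eigenvectors for \<open>z\<close> as the right and left kernel
  vectors of \<open>B\<close>. Since \<open>z\<close> is not a pole, no subdiagonal entry of the Hessenberg
  matrix \<open>B\<close> vanishes, so back substitution determines a kernel vector from its last
  entry and the kernel of \<open>B\<close> is the line through \<open>s\<close> (\<open>hessenberg_kernel_one_dim\<close>).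
  The eigenvalue is therefore simple, and this is where the Hessenberg form is needed:
  for a multiple eigenvalue of a normal pencil, \<open>s\<close> and \<open>r\<close> could be chosen independently
  of each other.

  Normality provides unitary coordinates in which \<open>H\<close>, \<open>K\<close>, and with them \<open>B\<close>, are diagonal.
  A diagonal matrix with a one-dimensional kernel has exactly one zero on its diagonal, at a
  position \<open>p\<close> say, and it has the same kernel as its adjoint. Hence \<open>s\<close> and \<open>r\<close> are
  multiples of the \<open>p\<close>-th basis vectors of the domain and of the codomain
  (\<open>simple_kernels_same_coordinate\<close>). So every matrix that is diagonal in these coordinates
  sends \<open>s\<close> to a multiple of \<open>r\<close>, and its adjoint sends \<open>r\<close> to a multiple of \<open>s\<close>
  (\<open>diagonal_equivalence_maps_line\<close>). For \<open>A = H\<close> and \<open>A = K\<close> these two relations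
  say that the first column and the first row of \<open>R\<^sup>H A S\<close> vanish off the diagonal
  (\<open>deflation\<close>).

  With \<open>H s = h r\<close> and \<open>K s = k r\<close>, the eigenvalue equation gives \<open>h = z k\<close>. If \<open>k\<close> were zero,
  both matrices would annihilate \<open>s\<close>; the independence of the last rows then forces the last
  entry of \<open>s\<close> to be zero (\<open>proper_common_kernel_last\<close>), and back substitution gives \<open>s = 0\<close>.
\<close>

section \<open>Adjoints and unitary matrices\<close>

lemma mat_adjoint_carrier [simp]:
  "A \<in> carrier_mat n k \<Longrightarrow> mat_adjoint A \<in> carrier_mat k n"
  unfolding mat_adjoint_def by auto

lemma mat_adjoint_dim [simp]:
  "dim_row (mat_adjoint A) = dim_col A" "dim_col (mat_adjoint A) = dim_row A"
  unfolding mat_adjoint_def by auto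

lemma mat_adjoint_index:
  assumes "A \<in> carrier_mat n k" "i < k" "j < n"
  shows "mat_adjoint A $$ (i, j) = conjugate (A $$ (j, i))"
  using assms unfolding mat_adjoint_def by (auto simp: mat_of_rows_def)

lemma mat_adjoint_mult:
  fixes A B :: "'a :: conjugatable_field mat"
  assumes A: "A \<in> carrier_mat n k" and B: "B \<in> carrier_mat k l"
  shows "mat_adjoint (A * B) = mat_adjoint B * mat_adjoint A"
proof (rule eq_matI)
  have AB: "A * B \<in> carrier_mat n l" using A B by simp
  have A': "mat_adjoint A \<in> carrier_mat k n" and B': "mat_adjoint B \<in> carrier_mat l k"
    using A B by simp_all
  fix i j assume "i < dim_row (mat_adjoint B * mat_adjoint A)"
    and "j < dim_col (mat_adjoint B * mat_adjoint A)"
  hence i: "i < l" and j: "j < n" using A' B' by auto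
  have "mat_adjoint (A * B) $$ (i, j) = conjugate ((A * B) $$ (j, i))"
    using mat_adjoint_index[OF AB i j] .
  also have "\<dots> = (\<Sum>t = 0..<k. conjugate (A $$ (j, t) * B $$ (t, i)))"
    using A B i j by (simp add: scalar_prod_def sum_conjugate)
  also have "\<dots> = (\<Sum>t = 0..<k. mat_adjoint B $$ (i, t) * mat_adjoint A $$ (t, j))"
    using mat_adjoint_index[OF A _ j] mat_adjoint_index[OF B i]
    by (intro sum.cong) (auto simp: conjugate_dist_mul mult.commute)
  also have "\<dots> = (mat_adjoint B * mat_adjoint A) $$ (i, j)"
    using A B i j by (simp add: scalar_prod_def)
  finally show "mat_adjoint (A * B) $$ (i, j) = (mat_adjoint B * mat_adjoint A) $$ (i, j)" .
next
  show "dim_row (mat_adjoint (A * B)) = dim_row (mat_adjoint B * mat_adjoint A)"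
    "dim_col (mat_adjoint (A * B)) = dim_col (mat_adjoint B * mat_adjoint A)"
    by simp_all
qed

lemma mat_adjoint_adjoint:
  fixes A :: "'a :: conjugatable_field mat"
  assumes A: "A \<in> carrier_mat n k"
  shows "mat_adjoint (mat_adjoint A) = A"
proof -
  have A': "mat_adjoint A \<in> carrier_mat k n" using A by simp
  show ?thesis
    using A mat_adjoint_index[OF A] mat_adjoint_index[OF A']
    by (intro eq_matI) auto
qed

lemma mat_adjoint_equivalence:
  fixes A :: "'a :: conjugatable_field mat"
  assumes A: "A \<in> carrier_mat n n" and R: "R \<in> carrier_mat n n" and S: "S \<in> carrier_mat n n"
  shows "mat_adjoint (mat_adjoint R * A * S) = mat_adjoint S * mat_adjoint A * R"
proof -
  have R': "mat_adjoint R \<in> carrier_mat n n" and S': "mat_adjoint S \<in> carrier_mat n n"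
    and A': "mat_adjoint A \<in> carrier_mat n n"
    using R S A by simp_all
  show ?thesis
    using mat_adjoint_mult[OF mult_carrier_mat[OF R' A] S] mat_adjoint_mult[OF R' A]
      mat_adjoint_adjoint[OF R] assoc_mult_mat[OF S' A' R] by simp
qed

lemma unitary_mat_carrier:
  assumes "unitary_mat m U"
  shows "U \<in> carrier_mat m m" "mat_adjoint U \<in> carrier_mat m m"
  using assms unfolding unitary_mat_def by simp_all

lemma unitary_mat_cancel:
  assumes U: "unitary_mat m U" and x: "x \<in> carrier_vec m"
  shows "mat_adjoint U *\<^sub>v (U *\<^sub>v x) = x" "U *\<^sub>v (mat_adjoint U *\<^sub>v x) = x"
  using U x assoc_mult_mat_vec[of "mat_adjoint U" m m U m x]
    assoc_mult_mat_vec[of U m m "mat_adjoint U" m x] unitary_mat_carrier[OF U]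
  unfolding unitary_mat_def by auto

lemma equivalence_carrier:
  assumes "A \<in> carrier_mat m m" "unitary_mat m R" "unitary_mat m S"
  shows "mat_adjoint R * A * S \<in> carrier_mat m m"
  using assms unitary_mat_carrier by (meson mult_carrier_mat)

lemma equivalence_mult_vec:
  assumes A: "A \<in> carrier_mat m m" and R: "unitary_mat m R" and S: "unitary_mat m S"
    and x: "x \<in> carrier_vec m"
  shows "mat_adjoint R * A * S *\<^sub>v x = mat_adjoint R *\<^sub>v (A *\<^sub>v (S *\<^sub>v x))"
proof -
  note RS = unitary_mat_carrier[OF R] unitary_mat_carrier[OF S]
  have "mat_adjoint R * A * S *\<^sub>v x = mat_adjoint R * A *\<^sub>v (S *\<^sub>v x)"
    using assoc_mult_mat_vec[OF mult_carrier_mat[OF RS(2) A] RS(3) x] .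
  also have "\<dots> = mat_adjoint R *\<^sub>v (A *\<^sub>v (S *\<^sub>v x))"
    using A x RS by (intro assoc_mult_mat_vec[of _ m m _ m]) simp_all
  finally show ?thesis .
qed

lemma smult_zero_vec_zero:
  fixes v :: "'a :: mult_zero vec"
  assumes "v \<in> carrier_vec n"
  shows "0 \<cdot>\<^sub>v v = 0\<^sub>v n"
  using assms by (intro eq_vecI) auto

lemma smult_mat_mult_vec:
  fixes A :: "'a :: comm_ring_1 mat"
  assumes "A \<in> carrier_mat n k" and "x \<in> carrier_vec k"
  shows "(c \<cdot>\<^sub>m A) *\<^sub>v x = c \<cdot>\<^sub>v (A *\<^sub>v x)"
  using assms by (intro eq_vecI) auto

text \<open>
  Written with the adjoint, the equation for a left eigenvector is a matrix-vector equation
  like the one for a right eigenvector, and both sides can be treated alike.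
\<close>

lemma left_eigenvector_adjoint:
  assumes H: "H \<in> carrier_mat m m" and K: "K \<in> carrier_mat m m"
    and r: "left_eigenvector m H K z r"
  shows "mat_adjoint (H - z \<cdot>\<^sub>m K) *\<^sub>v r = 0\<^sub>v m"
proof (rule eq_vecI)
  have rc: "r \<in> carrier_vec m"
    and eq: "mat_of_row (conjugate r) * H = z \<cdot>\<^sub>m (mat_of_row (conjugate r) * K)"
    using r unfolding left_eigenvector_def by auto
  have B: "H - z \<cdot>\<^sub>m K \<in> carrier_mat m m" using H K by auto
  fix j assume "j < dim_vec (0\<^sub>v m :: complex vec)"
  hence j: "j < m" by simp
  have *: "(mat_of_row (conjugate r) * A) $$ (0, j) = (\<Sum>i = 0..<m. cnj (r $ i) * A $$ (i, j))"
    if "A \<in> carrier_mat m m" for A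
    using that rc j by (auto simp: scalar_prod_def)
  have "(\<Sum>i = 0..<m. cnj (r $ i) * H $$ (i, j)) = z * (\<Sum>i = 0..<m. cnj (r $ i) * K $$ (i, j))"
    using arg_cong[OF eq, of "\<lambda>M. M $$ (0, j)"] *[OF H] *[OF K] rc K j by simp
  hence "(\<Sum>i = 0..<m. cnj (r $ i) * (H $$ (i, j) - z * K $$ (i, j))) = 0"
    by (simp add: right_diff_distrib sum_subtractf sum_distrib_left mult.left_commute)
  hence "cnj (\<Sum>i = 0..<m. cnj (r $ i) * (H $$ (i, j) - z * K $$ (i, j))) = 0" by simp
  hence "(\<Sum>i = 0..<m. cnj (H $$ (i, j) - z * K $$ (i, j)) * r $ i) = 0"
    by (simp add: mult.commute)
  moreover have "(mat_adjoint (H - z \<cdot>\<^sub>m K) *\<^sub>v r) $ j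
      = (\<Sum>i = 0..<m. cnj (H $$ (i, j) - z * K $$ (i, j)) * r $ i)"
    using rc H K j mat_adjoint_carrier[OF B] mat_adjoint_index[OF B j]
    by (auto simp: scalar_prod_def intro!: sum.cong)
  ultimately show "(mat_adjoint (H - z \<cdot>\<^sub>m K) *\<^sub>v r) $ j = 0\<^sub>v m $ j" using j by simp
next
  show "dim_vec (mat_adjoint (H - z \<cdot>\<^sub>m K) *\<^sub>v r) = dim_vec (0\<^sub>v m)"
    using K by simp
qed

section \<open>The kernel of an unreduced Hessenberg matrix\<close>

text \<open>
  Back substitution: once the entries of \<open>x\<close> after position \<open>l\<close> vanish, row \<open>l + 1\<close> of
  \<open>B x = 0\<close> reads \<open>B $$ (l + 1, l) * x $ l = 0\<close>, because the entries of that row to the left of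
  \<open>l\<close> are zero. Rows \<open>1\<close> to \<open>m - 1\<close> thus determine the entries \<open>0\<close> to \<open>m - 2\<close> from the last one.
\<close>

lemma hessenberg_kernel_zero:
  fixes x :: "complex vec"
  assumes B: "hessenberg_mat m B"
    and sub: "\<And>l. l < m - 1 \<Longrightarrow> B $$ (l + 1, l) \<noteq> 0"
    and x: "x \<in> carrier_vec m" and Bx: "B *\<^sub>v x = 0\<^sub>v m"
    and last: "x $ (m - 1) = 0"
  shows "x = 0\<^sub>v m"
proof -
  have Bc: "B \<in> carrier_mat m m" using B unfolding hessenberg_mat_def by simp
  have tail: "\<forall>j. m - 1 - k \<le> j \<and> j < m \<longrightarrow> x $ j = 0" for k
  proof (induction k)
    case 0
    show ?case
    proof (intro allI impI)
      fix j assume "m - 1 - 0 \<le> j \<and> j < m"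
      hence "j = m - 1" by auto
      thus "x $ j = 0" using last by simp
    qed
  next
    case (Suc k)
    show ?case
    proof (cases "k < m - 1")
      case True
      define l where "l = m - 1 - Suc k"
      have l: "l < m - 1" "Suc l = m - 1 - k" using True unfolding l_def by auto
      have "0 = (B *\<^sub>v x) $ (l + 1)" using Bx l by simp
      also have "\<dots> = (\<Sum>j = 0..<m. B $$ (l + 1, j) * x $ j)"
        using Bc x l by (simp add: scalar_prod_def)
      also have "\<dots> = (\<Sum>j = 0..<m. if j = l then B $$ (l + 1, l) * x $ l else 0)"
      proof (intro sum.cong refl)
        fix j assume "j \<in> {0..<m}"
        hence j: "j < m" by simp
        consider "j < l" | "j = l" | "j > l" by linarith
        thus "B $$ (l + 1, j) * x $ j = (if j = l then B $$ (l + 1, l) * x $ l else 0)"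
        proof cases
          case 1
          hence "B $$ (l + 1, j) = 0" using B l j unfolding hessenberg_mat_def by auto
          thus ?thesis using 1 by simp
        next
          case 3
          hence "x $ j = 0" using Suc.IH l j by auto
          thus ?thesis using 3 by simp
        qed simp
      qed
      also have "\<dots> = B $$ (l + 1, l) * x $ l" using l by simp
      finally have "x $ l = 0" using sub[OF l(1)] by simp
      show ?thesis
      proof (intro allI impI)
        fix j assume j: "m - 1 - Suc k \<le> j \<and> j < m"
        show "x $ j = 0"
        proof (cases "j = l")
          case False
          hence "m - 1 - k \<le> j" using j l unfolding l_def by linarith
          thus ?thesis using Suc.IH j by blast
        qed (use \<open>x $ l = 0\<close> in simp)
      qed
    next
      case False
      thus ?thesis using Suc.IH by simp
    qed
  qed
  show ?thesis
  proof (rule eq_vecI)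
    fix j assume "j < dim_vec (0\<^sub>v m :: complex vec)"
    thus "x $ j = 0\<^sub>v m $ j" using tail[of m] by simp
  qed (use x in simp)
qed

lemma hessenberg_kernel_one_dim:
  fixes s x :: "complex vec"
  assumes B: "hessenberg_mat m B"
    and sub: "\<And>l. l < m - 1 \<Longrightarrow> B $$ (l + 1, l) \<noteq> 0"
    and s: "s \<in> carrier_vec m" "s \<noteq> 0\<^sub>v m" "B *\<^sub>v s = 0\<^sub>v m"
    and x: "x \<in> carrier_vec m" "B *\<^sub>v x = 0\<^sub>v m"
  shows "\<exists>c. x = c \<cdot>\<^sub>v s"
proof -
  have Bc: "B \<in> carrier_mat m m" using B unfolding hessenberg_mat_def by simp
  have s0: "s $ (m - 1) \<noteq> 0" using hessenberg_kernel_zero[OF B sub s(1,3)] s(2) by auto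
  have m: "m > 0" using s by (cases m) auto
  define c where "c = x $ (m - 1) / s $ (m - 1)"
  have "B *\<^sub>v (x - c \<cdot>\<^sub>v s) = B *\<^sub>v x - c \<cdot>\<^sub>v (B *\<^sub>v s)"
    using mult_minus_distrib_mat_vec[OF Bc x(1), of "c \<cdot>\<^sub>v s"] mult_mat_vec[OF Bc s(1), of c] s(1)
    by simp
  also have "\<dots> = 0\<^sub>v m" using s(3) x(2) by auto
  finally have "B *\<^sub>v (x - c \<cdot>\<^sub>v s) = 0\<^sub>v m" .
  moreover have "(x - c \<cdot>\<^sub>v s) $ (m - 1) = 0" using s(1) x(1) s0 m by (simp add: c_def)
  ultimately have "x - c \<cdot>\<^sub>v s = 0\<^sub>v m"
    using hessenberg_kernel_zero[OF B sub, of "x - c \<cdot>\<^sub>v s"] s(1) x(1) by simp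
  hence diff: "(x - c \<cdot>\<^sub>v s) $ i = 0" if "i < m" for i using that by simp
  have "x = c \<cdot>\<^sub>v s"
  proof (rule eq_vecI)
    fix i assume "i < dim_vec (c \<cdot>\<^sub>v s)"
    thus "x $ i = (c \<cdot>\<^sub>v s) $ i" using diff[of i] s(1) x(1) by simp
  qed (use s(1) x(1) in simp)
  thus ?thesis ..
qed

section \<open>Consequences of properness\<close>

text \<open>
  Linear dependence is a property of sets, with coefficients given by a function on the
  vectors. Distinctness of \<open>v\<close> and \<open>w\<close> is what allows two arbitrary coefficients to be
  combined into such a function.
\<close>

lemma lin_indep_pair_coeffs:
  assumes "lin_indep_pair m v w" and v: "v \<in> carrier_vec m" and w: "w \<in> carrier_vec m"
    and eq: "\<And>i. i < m \<Longrightarrow> a * v $ i + b * w $ i = 0"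
  shows "a = 0 \<and> b = 0"
proof (rule ccontr)
  assume nz: "\<not> (a = 0 \<and> b = 0)"
  interpret vec_space "TYPE(complex)" m .
  have vw: "v \<noteq> w" and ind: "\<not> lin_dep {v, w}"
    using assms(1) unfolding lin_indep_pair_def by auto
  let ?c = "\<lambda>u. if u = v then a else b"
  have X: "{v, w} \<subseteq> carrier_vec m" using v w by simp
  have "lincomb ?c {v, w} = 0\<^sub>v m"
  proof (rule eq_vecI)
    fix i assume "i < dim_vec (0\<^sub>v m :: complex vec)"
    hence i: "i < m" by simp
    show "lincomb ?c {v, w} $ i = 0\<^sub>v m $ i"
      using lincomb_index[OF i X, of ?c] eq[OF i] vw i by auto
  qed (use lincomb_dim[OF _ X] in auto)
  moreover obtain u where "u \<in> {v, w}" "?c u \<noteq> 0"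
    using nz vw that[of v] that[of w] by fastforce
  ultimately have "lin_dep {v, w}"
    unfolding lin_dep_def by (intro exI[of _ "{v, w}"] exI[of _ ?c] exI[of _ u]) auto
  thus False using ind by simp
qed

text \<open>
  The last rows have at most two nonzero entries each. Some nontrivial combination of
  them cancels the subdiagonal entries and is supported on the last position; it is not zero, by
  independence, and it annihilates \<open>s\<close>, so the last entry of \<open>s\<close> vanishes.
\<close>

lemma proper_common_kernel_last:
  assumes hess: "hessenberg_pencil m H K" and proper: "proper_pencil m H K"
    and m: "m > 0" and s: "s \<in> carrier_vec m"
    and Hs: "H *\<^sub>v s = 0\<^sub>v m" and Ks: "K *\<^sub>v s = 0\<^sub>v m"
  shows "s $ (m - 1) = 0"
proof (rule ccontr)
  assume y: "s $ (m - 1) \<noteq> 0"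
  have H: "H \<in> carrier_mat m m" and K: "K \<in> carrier_mat m m"
    and HK0: "\<And>j. j + 2 < m \<Longrightarrow> H $$ (m - 1, j) = 0 \<and> K $$ (m - 1, j) = 0"
    using hess unfolding hessenberg_pencil_def hessenberg_mat_def by auto
  obtain a b where ab: "\<not> (a = 0 \<and> b = 0)"
    and kill: "\<And>j. j < m - 1 \<Longrightarrow> a * H $$ (m - 1, j) + b * K $$ (m - 1, j) = 0"
  proof (cases "m = 1")
    case True
    \<comment> \<open>There is no subdiagonal entry to cancel, so any nonzero pair of coefficients will do.\<close>
    thus ?thesis using that[of 1 0] by simp
  next
    case False
    let ?h = "H $$ (m - 1, m - 2)" and ?k = "K $$ (m - 1, m - 2)"
    have "m - 2 < m - 1" "m - 2 + 1 = m - 1" using False m by auto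
    hence "cmod ?h + cmod ?k \<noteq> 0"
      using proper[unfolded proper_pencil_def, THEN conjunct1, rule_format, of "m - 2"] by simp
    hence "\<not> (?k = 0 \<and> - ?h = 0)" by auto
    moreover have "?k * H $$ (m - 1, j) + (- ?h) * K $$ (m - 1, j) = 0" if "j < m - 1" for j
    proof (cases "j = m - 2")
      case False
      thus ?thesis using HK0[of j] that by simp
    qed simp
    ultimately show ?thesis using that by blast
  qed
  let ?g = "\<lambda>j. a * H $$ (m - 1, j) + b * K $$ (m - 1, j)"
  have "(\<Sum>j = 0..<m. H $$ (m - 1, j) * s $ j) = 0"
    using arg_cong[OF Hs, of "\<lambda>v. v $ (m - 1)"] H s m by (simp add: scalar_prod_def)
  moreover have "(\<Sum>j = 0..<m. K $$ (m - 1, j) * s $ j) = 0"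
    using arg_cong[OF Ks, of "\<lambda>v. v $ (m - 1)"] K s m by (simp add: scalar_prod_def)
  moreover have "(\<Sum>j = 0..<m. ?g j * s $ j)
      = a * (\<Sum>j = 0..<m. H $$ (m - 1, j) * s $ j) + b * (\<Sum>j = 0..<m. K $$ (m - 1, j) * s $ j)"
    by (simp add: sum_distrib_left sum.distrib distrib_right mult.assoc)
  ultimately have "0 = (\<Sum>j = 0..<m. ?g j * s $ j)" by simp
  also have "\<dots> = (\<Sum>j = 0..<m. if j = m - 1 then ?g (m - 1) * s $ (m - 1) else 0)"
    using kill by (intro sum.cong) auto
  also have "\<dots> = ?g (m - 1) * s $ (m - 1)" using m by simp
  finally have "?g (m - 1) = 0" using y by simp
  hence "?g j = 0" if "j < m" for j using kill[of j] that by (cases "j = m - 1") auto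
  moreover have "lin_indep_pair m (row H (m - 1)) (row K (m - 1))"
    using proper unfolding proper_pencil_def by simp
  ultimately show False
    using ab lin_indep_pair_coeffs[of m "row H (m - 1)" "row K (m - 1)" a b]
      row_carrier_vec[of "m - 1" m H m] row_carrier_vec[of "m - 1" m K m] H K m
    by fastforce
qed

text \<open>
  If \<open>K\<close> has a nonzero subdiagonal entry in position \<open>l\<close>, the entry of \<open>H - z K\<close> is zero exactly
  when the pole equals \<open>z\<close>. If the entry of \<open>K\<close> is zero, the pole is infinite and the entry of \<open>H - z K\<close> is that
  of \<open>H\<close>, which is nonzero because the pencil is proper.
\<close>

lemma shifted_pencil_unreduced:
  assumes hess: "hessenberg_pencil m H K" and proper: "proper_pencil m H K"
    and not_pole: "Finite z \<notin> poles m H K"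
  shows "hessenberg_mat m (H - z \<cdot>\<^sub>m K)"
    and "\<And>l. l < m - 1 \<Longrightarrow> (H - z \<cdot>\<^sub>m K) $$ (l + 1, l) \<noteq> 0"
proof -
  have H: "H \<in> carrier_mat m m" and K: "K \<in> carrier_mat m m"
    using hess unfolding hessenberg_pencil_def hessenberg_mat_def by auto
  show "hessenberg_mat m (H - z \<cdot>\<^sub>m K)"
    using hess H K unfolding hessenberg_pencil_def hessenberg_mat_def by auto
  fix l assume l: "l < m - 1"
  have "pole H K l \<noteq> Finite z" using not_pole l unfolding poles_def by force
  moreover have "cmod (H $$ (l + 1, l)) + cmod (K $$ (l + 1, l)) \<noteq> 0"
    using proper l unfolding proper_pencil_def by simp
  ultimately have "H $$ (l + 1, l) - z * K $$ (l + 1, l) \<noteq> 0"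
    unfolding pole_def by (auto split: if_splits)
  thus "(H - z \<cdot>\<^sub>m K) $$ (l + 1, l) \<noteq> 0" using H K l by simp
qed

section \<open>Diagonalization by a unitary equivalence\<close>

lemma diagonal_mult_vec:
  fixes D :: "complex mat"
  assumes D: "D \<in> carrier_mat m m" and diag: "diagonal_mat D"
    and x: "x \<in> carrier_vec m" and i: "i < m"
  shows "(D *\<^sub>v x) $ i = D $$ (i, i) * x $ i"
proof -
  have "(D *\<^sub>v x) $ i = (\<Sum>j = 0..<m. D $$ (i, j) * x $ j)"
    using D x i by (simp add: scalar_prod_def)
  also have "\<dots> = (\<Sum>j = 0..<m. if j = i then D $$ (i, i) * x $ i else 0)"
    using D diag i unfolding diagonal_mat_def by (intro sum.cong) auto
  also have "\<dots> = D $$ (i, i) * x $ i" using i by simp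
  finally show ?thesis .
qed

lemma diagonal_mat_adjoint:
  assumes D: "D \<in> carrier_mat m m" and diag: "diagonal_mat D"
  shows "diagonal_mat (mat_adjoint D)"
  using mat_adjoint_index[OF D] mat_adjoint_carrier[OF D] D diag
  unfolding diagonal_mat_def by auto

text \<open>
  A diagonal matrix preserves each coordinate line. The lemma is applied both to a
  matrix and, with the roles of \<open>R\<close> and \<open>S\<close> exchanged, to its adjoint.
\<close>

lemma diagonal_equivalence_maps_line:
  assumes A: "A \<in> carrier_mat m m" and R: "unitary_mat m R" and S: "unitary_mat m S"
    and diag: "diagonal_mat (mat_adjoint R * A * S)"
    and x: "x \<in> carrier_vec m" and y: "y \<in> carrier_vec m"
    and xp: "mat_adjoint S *\<^sub>v x = a \<cdot>\<^sub>v unit_vec m p"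
    and yp: "mat_adjoint R *\<^sub>v y = b \<cdot>\<^sub>v unit_vec m p" and b: "b \<noteq> 0"
  shows "\<exists>c. A *\<^sub>v x = c \<cdot>\<^sub>v y"
proof -
  note RS = unitary_mat_carrier[OF R] unitary_mat_carrier[OF S]
  define D where "D = mat_adjoint R * A * S"
  have D: "D \<in> carrier_mat m m" using equivalence_carrier[OF A R S] unfolding D_def .
  define c where "c = a * D $$ (p, p) / b"
  have "mat_adjoint R *\<^sub>v (A *\<^sub>v x) = D *\<^sub>v (mat_adjoint S *\<^sub>v x)"
    using equivalence_mult_vec[OF A R S, of "mat_adjoint S *\<^sub>v x"] unitary_mat_cancel(2)[OF S x] RS x
    unfolding D_def by simp
  also have "\<dots> = D *\<^sub>v (a \<cdot>\<^sub>v unit_vec m p)" using xp by simp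
  also have "\<dots> = (c * b) \<cdot>\<^sub>v unit_vec m p"
  proof (rule eq_vecI)
    fix i assume "i < dim_vec ((c * b) \<cdot>\<^sub>v unit_vec m p)"
    hence "i < m" by simp
    thus "(D *\<^sub>v (a \<cdot>\<^sub>v unit_vec m p)) $ i = ((c * b) \<cdot>\<^sub>v unit_vec m p) $ i"
      using diagonal_mult_vec[OF D, of "a \<cdot>\<^sub>v unit_vec m p" i] diag b
      unfolding D_def[symmetric] by (cases "i = p") (auto simp: c_def unit_vec_def)
  qed (use D in simp)
  also have "\<dots> = mat_adjoint R *\<^sub>v (c \<cdot>\<^sub>v y)"
    using mult_mat_vec[OF RS(2) y, of c] yp by (simp add: smult_smult_assoc)
  finally have "R *\<^sub>v (mat_adjoint R *\<^sub>v (A *\<^sub>v x)) = R *\<^sub>v (mat_adjoint R *\<^sub>v (c \<cdot>\<^sub>v y))"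
    by simp
  hence "A *\<^sub>v x = c \<cdot>\<^sub>v y" using unitary_mat_cancel(2)[OF R] A x y by simp
  thus ?thesis ..
qed

text \<open>
  A second zero on the diagonal, at \<open>q\<close>, would put \<open>S e\<^sub>q\<close> into the kernel of \<open>B\<close>, hence on
  the line of \<open>s\<close>; but \<open>s\<close> has a nonzero coordinate at another position \<open>p\<close>. The
  adjoint has its diagonal zeros at the same positions, so one-dimensionality of the left
  kernel follows from that of the right kernel.
\<close>

lemma simple_kernels_same_coordinate:
  assumes B: "B \<in> carrier_mat m m" and R: "unitary_mat m R" and S: "unitary_mat m S"
    and diag: "diagonal_mat (mat_adjoint R * B * S)"
    and s: "s \<in> carrier_vec m" "s \<noteq> 0\<^sub>v m" "B *\<^sub>v s = 0\<^sub>v m"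
    and simple: "\<And>x. x \<in> carrier_vec m \<Longrightarrow> B *\<^sub>v x = 0\<^sub>v m \<Longrightarrow> \<exists>c. x = c \<cdot>\<^sub>v s"
    and r: "r \<in> carrier_vec m" "r \<noteq> 0\<^sub>v m" "mat_adjoint B *\<^sub>v r = 0\<^sub>v m"
  obtains p a b where "a \<noteq> 0" "b \<noteq> 0" "mat_adjoint S *\<^sub>v s = a \<cdot>\<^sub>v unit_vec m p"
    "mat_adjoint R *\<^sub>v r = b \<cdot>\<^sub>v unit_vec m p"
proof -
  note RS = unitary_mat_carrier[OF R] unitary_mat_carrier[OF S]
  define D where "D = mat_adjoint R * B * S"
  have D: "D \<in> carrier_mat m m" using equivalence_carrier[OF B R S] unfolding D_def .
  have diagD: "diagonal_mat D" using diag unfolding D_def .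
  have D': "mat_adjoint D \<in> carrier_mat m m" using D by simp
  have B': "mat_adjoint B \<in> carrier_mat m m" using B by simp
  define u where "u = mat_adjoint S *\<^sub>v s"
  define v where "v = mat_adjoint R *\<^sub>v r"
  have uv: "u \<in> carrier_vec m" "v \<in> carrier_vec m" using mult_mat_vec_carrier[OF RS(4) s(1)] mult_mat_vec_carrier[OF RS(2) r(1)]
    unfolding u_def v_def by simp_all
  have zero: "U *\<^sub>v 0\<^sub>v m = 0\<^sub>v m" if "U \<in> carrier_mat m m" for U :: "complex mat"
    using that by (intro eq_vecI) auto
  have Su: "S *\<^sub>v u = s" and Rv: "R *\<^sub>v v = r"
    using unitary_mat_cancel(2)[OF S s(1)] unitary_mat_cancel(2)[OF R r(1)]
    unfolding u_def v_def by simp_all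
  have u0: "u \<noteq> 0\<^sub>v m" and v0: "v \<noteq> 0\<^sub>v m" using Su Rv zero RS s(2) r(2) by auto
  have "D *\<^sub>v u = 0\<^sub>v m"
    using equivalence_mult_vec[OF B R S uv(1)] Su s(3) zero RS unfolding D_def by simp
  hence Du: "D $$ (i, i) * u $ i = 0" if "i < m" for i
    using diagonal_mult_vec[OF D diagD uv(1) that] that by simp
  have "mat_adjoint D *\<^sub>v v = 0\<^sub>v m"
    using equivalence_mult_vec[OF B' S R uv(2)] Rv r(3) zero RS
      mat_adjoint_equivalence[OF B RS(1) RS(3)] unfolding D_def by simp
  hence Dv: "cnj (D $$ (i, i)) * v $ i = 0" if "i < m" for i
    using diagonal_mult_vec[OF D' diagonal_mat_adjoint[OF D diagD] uv(2) that]
      mat_adjoint_index[OF D that that] that by simp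
  obtain p where p: "p < m" "u $ p \<noteq> 0" using u0 uv(1) by (metis carrier_vecD eq_vecI index_zero_vec)
  have Dq: "D $$ (q, q) \<noteq> 0" if q: "q < m" "q \<noteq> p" for q
  proof
    assume 0: "D $$ (q, q) = 0"
    have "D *\<^sub>v unit_vec m q = 0\<^sub>v m"
    proof (rule eq_vecI)
      fix i assume "i < dim_vec (0\<^sub>v m :: complex vec)"
      thus "(D *\<^sub>v unit_vec m q) $ i = 0\<^sub>v m $ i"
        using diagonal_mult_vec[OF D diagD, of "unit_vec m q" i] 0 by (cases "i = q") (auto simp: unit_vec_def)
    qed (use D in simp)
    hence "mat_adjoint R *\<^sub>v (B *\<^sub>v (S *\<^sub>v unit_vec m q)) = 0\<^sub>v m"
      using equivalence_mult_vec[OF B R S, of "unit_vec m q"] unfolding D_def by simp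
    hence "B *\<^sub>v (S *\<^sub>v unit_vec m q) = 0\<^sub>v m"
      using unitary_mat_cancel(2)[OF R, of "B *\<^sub>v (S *\<^sub>v unit_vec m q)"] zero RS B by simp
    then obtain c where "S *\<^sub>v unit_vec m q = c \<cdot>\<^sub>v s"
      using simple[of "S *\<^sub>v unit_vec m q"] RS by auto
    hence e: "unit_vec m q = c \<cdot>\<^sub>v u"
      using unitary_mat_cancel(1)[OF S, of "unit_vec m q"] mult_mat_vec[OF RS(4) s(1), of c]
      unfolding u_def by simp
    have "c * u $ p = 0" using arg_cong[OF e, of "\<lambda>w. w $ p"] p q uv by simp
    hence "c = 0" using p by simp
    thus False using arg_cong[OF e, of "\<lambda>w. w $ q"] q uv by simp
  qed
  have up: "u = u $ p \<cdot>\<^sub>v unit_vec m p"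
  proof (rule eq_vecI)
    fix i assume "i < dim_vec (u $ p \<cdot>\<^sub>v unit_vec m p)"
    thus "u $ i = (u $ p \<cdot>\<^sub>v unit_vec m p) $ i" using Du[of i] Dq[of i] by (cases "i = p") (auto simp: unit_vec_def)
  qed (use uv in simp)
  have vp: "v = v $ p \<cdot>\<^sub>v unit_vec m p"
  proof (rule eq_vecI)
    fix i assume "i < dim_vec (v $ p \<cdot>\<^sub>v unit_vec m p)"
    thus "v $ i = (v $ p \<cdot>\<^sub>v unit_vec m p) $ i" using Dv[of i] Dq[of i] by (cases "i = p") (auto simp: unit_vec_def)
  qed (use uv in simp)
  have "v $ p \<noteq> 0"
  proof
    assume "v $ p = 0"
    hence "v = 0\<^sub>v m" using vp smult_zero_vec_zero[of "unit_vec m p" m] by simp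
    thus False using v0 by simp
  qed
  thus thesis using that p(2) up vp unfolding u_def v_def by blast
qed

section \<open>Deflation\<close>

lemma four_block_mat_of_unit_vec:
  fixes M :: "complex mat"
  assumes M: "M \<in> carrier_mat m m" and m: "m > 0"
    and col: "M *\<^sub>v unit_vec m 0 = c \<cdot>\<^sub>v unit_vec m 0"
    and row: "mat_adjoint M *\<^sub>v unit_vec m 0 = d \<cdot>\<^sub>v unit_vec m 0"
  shows "\<exists>M' \<in> carrier_mat (m - 1) (m - 1). M =
    four_block_mat (mat 1 1 (\<lambda>_. c)) (0\<^sub>m 1 (m - 1)) (0\<^sub>m (m - 1) 1) M'"
proof -
  have M': "mat_adjoint M \<in> carrier_mat m m" using M by simp
  have c: "M $$ (i, 0) = (if i = 0 then c else 0)" if "i < m" for i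
    using arg_cong[OF col, of "\<lambda>v. v $ i"] M that m by auto
  have "cnj (M $$ (0, j)) = (if j = 0 then d else 0)" if "j < m" for j
    using arg_cong[OF row, of "\<lambda>v. v $ j"] M that m mat_adjoint_index[OF M that m] by auto
  hence d: "M $$ (0, j) = 0" if "j < m" "j \<noteq> 0" for j using that by force
  let ?N = "mat (m - 1) (m - 1) (\<lambda>(i, j). M $$ (i + 1, j + 1))"
  have "M = four_block_mat (mat 1 1 (\<lambda>_. c)) (0\<^sub>m 1 (m - 1)) (0\<^sub>m (m - 1) 1) ?N"
    using M m c d by (intro eq_matI) (auto simp: not_less)
  thus ?thesis by (intro bexI[of _ ?N]) auto
qed

text \<open>
  The first column of \<open>R\<^sup>H A S\<close> is \<open>R\<^sup>H A s\<close>, and the first column of its adjoint is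
  \<open>S\<^sup>H A\<^sup>H r\<close>; unitarity turns \<open>R\<^sup>H r\<close> and \<open>S\<^sup>H s\<close> into the first basis vector.
\<close>

lemma deflation:
  assumes A: "A \<in> carrier_mat m m" and m: "m > 0"
    and R: "unitary_mat m R" and S: "unitary_mat m S"
    and r: "R *\<^sub>v unit_vec m 0 = r" and s: "S *\<^sub>v unit_vec m 0 = s"
    and As: "A *\<^sub>v s = c \<cdot>\<^sub>v r" and Ar: "mat_adjoint A *\<^sub>v r = d \<cdot>\<^sub>v s"
  shows "\<exists>A' \<in> carrier_mat (m - 1) (m - 1). mat_adjoint R * A * S =
    four_block_mat (mat 1 1 (\<lambda>_. c)) (0\<^sub>m 1 (m - 1)) (0\<^sub>m (m - 1) 1) A'"
proof (rule four_block_mat_of_unit_vec)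
  note RS = unitary_mat_carrier[OF R] unitary_mat_carrier[OF S]
  have A': "mat_adjoint A \<in> carrier_mat m m" using A by simp
  have e: "unit_vec m 0 \<in> carrier_vec m" by simp
  have rs: "r \<in> carrier_vec m" "s \<in> carrier_vec m"
    using r s mult_mat_vec_carrier[OF RS(1) e] mult_mat_vec_carrier[OF RS(3) e] by simp_all
  have re: "mat_adjoint R *\<^sub>v r = unit_vec m 0" and se: "mat_adjoint S *\<^sub>v s = unit_vec m 0"
    using unitary_mat_cancel(1)[OF R e] unitary_mat_cancel(1)[OF S e] r s by simp_all
  show "mat_adjoint R * A * S \<in> carrier_mat m m" using equivalence_carrier[OF A R S] .
  show "mat_adjoint R * A * S *\<^sub>v unit_vec m 0 = c \<cdot>\<^sub>v unit_vec m 0"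
    using equivalence_mult_vec[OF A R S e] s As mult_mat_vec[OF RS(2) rs(1), of c] re by simp
  show "mat_adjoint (mat_adjoint R * A * S) *\<^sub>v unit_vec m 0 = d \<cdot>\<^sub>v unit_vec m 0"
    using equivalence_mult_vec[OF A' S R e] r Ar mult_mat_vec[OF RS(4) rs(2), of d] se
      mat_adjoint_equivalence[OF A RS(1) RS(3)] by simp
qed (rule m)

theorem theorem7p1:
  fixes m :: nat
    and H K R S :: "complex mat"
    and r s :: "complex vec"
    and z :: complex
  assumes hess: "hessenberg_pencil m H K"
    and proper: "proper_pencil m H K"
    and normal: "normal_pencil m H K"
    and eig: "pencil_eigenvalue H K z"
    and not_pole: "Finite z \<notin> poles m H K"
    and right_eig: "right_eigenvector m H K z s"
    and left_eig: "left_eigenvector m H K z r"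
    and norm_s: "vec_norm2 s = 1"
    and norm_r: "vec_norm2 r = 1"
    and unitary_R: "unitary_mat m R"
    and unitary_S: "unitary_mat m S"
    and R_e1: "R *\<^sub>v unit_vec m 0 = r"
    and S_e1: "S *\<^sub>v unit_vec m 0 = s"
  shows "\<exists>(h::complex) (k::complex) H' K'.
    H' \<in> carrier_mat (m - 1) (m - 1) \<and>
    K' \<in> carrier_mat (m - 1) (m - 1) \<and>
    mat_adjoint R * H * S =
      four_block_mat (mat 1 1 (\<lambda>_. h)) (0\<^sub>m 1 (m - 1)) (0\<^sub>m (m - 1) 1) H' \<and>
    mat_adjoint R * K * S =
      four_block_mat (mat 1 1 (\<lambda>_. k)) (0\<^sub>m 1 (m - 1)) (0\<^sub>m (m - 1) 1) K' \<and>
    k \<noteq> 0 \<and> h / k = z"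
proof -
  have H: "H \<in> carrier_mat m m" and K: "K \<in> carrier_mat m m"
    using hess unfolding hessenberg_pencil_def hessenberg_mat_def by auto
  have s: "s \<in> carrier_vec m" "s \<noteq> 0\<^sub>v m" and Hs: "H *\<^sub>v s = z \<cdot>\<^sub>v (K *\<^sub>v s)"
    using right_eig unfolding right_eigenvector_def by auto
  have r: "r \<in> carrier_vec m" "r \<noteq> 0\<^sub>v m"
    using left_eig unfolding left_eigenvector_def by auto
  have m: "m > 0" using s by (cases m) auto
  define B where "B = H - z \<cdot>\<^sub>m K"
  have B: "B \<in> carrier_mat m m" using H K unfolding B_def by auto
  have hessB: "hessenberg_mat m B" and sub: "\<And>l. l < m - 1 \<Longrightarrow> B $$ (l + 1, l) \<noteq> 0"
    using shifted_pencil_unreduced[OF hess proper not_pole] unfolding B_def by auto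
  have Bs: "B *\<^sub>v s = 0\<^sub>v m"
    using minus_mult_distrib_mat_vec[OF H _ s(1), of "z \<cdot>\<^sub>m K"] K Hs s
      smult_mat_mult_vec[OF K s(1), of z] unfolding B_def by auto
  have Br: "mat_adjoint B *\<^sub>v r = 0\<^sub>v m"
    using left_eigenvector_adjoint[OF H K left_eig] unfolding B_def .
  obtain R1 S1 where R1: "unitary_mat m R1" and S1: "unitary_mat m S1"
    and dH: "diagonal_mat (mat_adjoint R1 * H * S1)"
    and dK: "diagonal_mat (mat_adjoint R1 * K * S1)"
    using normal unfolding normal_pencil_def by blast
  note RS = unitary_mat_carrier[OF R1] unitary_mat_carrier[OF S1]
  have "mat_adjoint R1 * B * S1 = mat_adjoint R1 * H * S1 - z \<cdot>\<^sub>m (mat_adjoint R1 * K * S1)"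
  proof -
    have "mat_adjoint R1 * B = mat_adjoint R1 * H - z \<cdot>\<^sub>m (mat_adjoint R1 * K)"
      using mult_minus_distrib_mat[OF RS(2) H, of "z \<cdot>\<^sub>m K"] K mult_smult_distrib[OF RS(2) K, of z]
      unfolding B_def by simp
    moreover have "(mat_adjoint R1 * H - z \<cdot>\<^sub>m (mat_adjoint R1 * K)) * S1
        = mat_adjoint R1 * H * S1 - z \<cdot>\<^sub>m (mat_adjoint R1 * K) * S1"
      using RS H K by (intro minus_mult_distrib_mat[of _ m m]) auto
    moreover have "z \<cdot>\<^sub>m (mat_adjoint R1 * K) * S1 = z \<cdot>\<^sub>m (mat_adjoint R1 * K * S1)"
      using RS K by (intro mult_smult_assoc_mat[of _ m m]) auto
    ultimately show ?thesis by simp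
  qed
  hence dB: "diagonal_mat (mat_adjoint R1 * B * S1)"
    using dH dK RS H K unfolding diagonal_mat_def by auto
  obtain p a b where a: "a \<noteq> 0" and b: "b \<noteq> 0"
    and sp: "mat_adjoint S1 *\<^sub>v s = a \<cdot>\<^sub>v unit_vec m p"
    and rp: "mat_adjoint R1 *\<^sub>v r = b \<cdot>\<^sub>v unit_vec m p"
    using simple_kernels_same_coordinate[OF B R1 S1 dB s Bs
        hessenberg_kernel_one_dim[OF hessB sub s Bs] r Br] by blast
  have maps: "(\<exists>c. A *\<^sub>v s = c \<cdot>\<^sub>v r) \<and> (\<exists>d. mat_adjoint A *\<^sub>v r = d \<cdot>\<^sub>v s)"
    if A: "A \<in> carrier_mat m m" and dA: "diagonal_mat (mat_adjoint R1 * A * S1)" for A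
  proof
    show "\<exists>c. A *\<^sub>v s = c \<cdot>\<^sub>v r"
      using diagonal_equivalence_maps_line[OF A R1 S1 dA s(1) r(1) sp rp b] .
    have "diagonal_mat (mat_adjoint S1 * mat_adjoint A * R1)"
      using diagonal_mat_adjoint[OF equivalence_carrier[OF A R1 S1] dA]
        mat_adjoint_equivalence[OF A RS(1) RS(3)] by simp
    thus "\<exists>d. mat_adjoint A *\<^sub>v r = d \<cdot>\<^sub>v s"
      using diagonal_equivalence_maps_line[OF _ S1 R1 _ r(1) s(1) rp sp a] A by simp
  qed
  obtain h h' where h: "H *\<^sub>v s = h \<cdot>\<^sub>v r" and h': "mat_adjoint H *\<^sub>v r = h' \<cdot>\<^sub>v s"
    using maps[OF H dH] by blast
  obtain k k' where k: "K *\<^sub>v s = k \<cdot>\<^sub>v r" and k': "mat_adjoint K *\<^sub>v r = k' \<cdot>\<^sub>v s"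
    using maps[OF K dK] by blast
  \<comment> \<open>Otherwise \<open>s\<close> would be a common kernel vector, which a proper pencil does not have.\<close>
  have k0: "k \<noteq> 0"
  proof
    assume "k = 0"
    hence Ks: "K *\<^sub>v s = 0\<^sub>v m" using k r(1) by (simp add: smult_zero_vec_zero)
    hence "H *\<^sub>v s = 0\<^sub>v m" using Hs by auto
    hence "s $ (m - 1) = 0" using proper_common_kernel_last[OF hess proper m s(1) _ Ks] by simp
    hence "s = 0\<^sub>v m" using hessenberg_kernel_zero[OF hessB sub s(1) Bs] by simp
    thus False using s by simp
  qed
  have "h = z * k"
  proof -
    obtain i where i: "i < m" "r $ i \<noteq> 0" using r by (metis carrier_vecD eq_vecI index_zero_vec)
    have hr: "h \<cdot>\<^sub>v r = z \<cdot>\<^sub>v (k \<cdot>\<^sub>v r)" using h k Hs by simp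
    have "h * r $ i = z * k * r $ i"
      using arg_cong[OF hr, of "\<lambda>v. v $ i"] i(1) r(1) by (simp add: mult.assoc)
    thus ?thesis using i by simp
  qed
  hence hk: "h / k = z" using k0 by simp
  show ?thesis
    using deflation[OF H m unitary_R unitary_S R_e1 S_e1 h h']
      deflation[OF K m unitary_R unitary_S R_e1 S_e1 k k'] k0 hk by blast
qed

end
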